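(* Let $G=(V,E)$ be a connected, $k$-regular (unweighted) graph on $n$ vertices with modularity matrix $M$, and let $f\in\mathbb{R}^n$ be an eigenvector associated to the algebraic modularity $m(G)$: $Mf=m(G)f$. Let $w_1\ge w_2\ge\ldots\ge w_n$ be the values of $f_1,\ldots,f_n$ sorted in nonincreasing order. Introduce the sets $S_i=\{j:f_j\le w_i\}$, $i=1,\ldots,n$, and let $Q_\star=\max_i Q(S_i)$. Then $$Q_\star\ge\frac{1}{w_1-w_n}\left(\frac{k}{2}\|f\|_1-\|f\|_2\sqrt{(k-m(G))\frac{kn}{2}}\right).$$
   Context: $G=(V,E)$, $V=\{1,\dots,n\}$, is a finite simple undirected unweighted graph with 0/1 adjacency matrix $A$; $k$-regular means that every degree $d_i=\sum_j a_{ij}$ equals $k$. Put $d=(d_1,\dots,d_n)^T$ and $\mathrm{vol}\,G=\sum_i d_i$. The modularity matrix is $M=A-\frac{1}{\mathrm{vol}\,G}dd^T$. For $S\subseteq V$ with characteristic vector $\mathbf 1_S$, the modularity of $S$ is $Q(S)=\mathbf 1_S^TM\mathbf 1_S=\sum_{i,j\in S}a_{ij}-(\sum_{i\in S}d_i)^2/\mathrm{vol}\,G$. The algebraic modularity of $G$ is $m(G)=\max_{0\neq x\in\mathbb{R}^n,\ x^T\mathbf 1=0}\frac{x^TMx}{x^Tx}$, where $\mathbf 1$ is the all-ones vector. $\|\cdot\|_1,\|\cdot\|_2$ are the usual vector norms on $\mathbb{R}^n$. *)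

theory Defs
  imports "HOL-Analysis.Analysis" "HOL-Library.Multiset" "Graph_Theory.Graph_Theory"
begin

text \<open>
  A finite simple undirected graph is a symmetric loop-free digraph without parallel arcs
  (\<^locale>\<open>pair_graph\<close>).  Its vertex set is taken to be the whole finite type \<open>'n\<close>, so that
  \<open>real ^ 'n\<close> is the space of vectors indexed by the vertices.
\<close>

definition adjacency_matrix :: "'n::finite pair_pre_digraph \<Rightarrow> real ^ 'n ^ 'n" where
  "adjacency_matrix G = (\<chi> i j. if (i, j) \<in> parcs G then 1 else 0)"

definition degree_vec :: "'n::finite pair_pre_digraph \<Rightarrow> real ^ 'n" where
  "degree_vec G = (\<chi> i. \<Sum>j\<in>UNIV. adjacency_matrix G $ i $ j)"

definition regular_graph :: "nat \<Rightarrow> 'n::finite pair_pre_digraph \<Rightarrow> bool" where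
  "regular_graph k G \<longleftrightarrow> (\<forall>i. degree_vec G $ i = real k)"

definition graph_volume :: "'n::finite pair_pre_digraph \<Rightarrow> real" where
  "graph_volume G = (\<Sum>i\<in>UNIV. degree_vec G $ i)"

text \<open>If \<open>G\<close> has no edges, the volume is \<open>0\<close> and the modularity matrix is the zero matrix.\<close>

definition modularity_matrix :: "'n::finite pair_pre_digraph \<Rightarrow> real ^ 'n ^ 'n" where
  "modularity_matrix G =
     (\<chi> i j. adjacency_matrix G $ i $ j - degree_vec G $ i * degree_vec G $ j / graph_volume G)"

definition char_vec :: "'n::finite set \<Rightarrow> real ^ 'n" where
  "char_vec S = (\<chi> i. if i \<in> S then 1 else 0)"

definition modularity :: "'n::finite pair_pre_digraph \<Rightarrow> 'n set \<Rightarrow> real" where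
  "modularity G S = char_vec S \<bullet> (modularity_matrix G *v char_vec S)"

text \<open>
  The maximum defining the algebraic modularity is over an infinite set of Rayleigh quotients,
  hence \<^const>\<open>Greatest\<close> rather than \<^const>\<open>Max\<close>.  For a one-vertex graph there is no admissible
  vector and the value is unspecified; otherwise the maximum is attained
  (lemma \<open>algebraic_modularity_attained\<close>).
\<close>

definition algebraic_modularity :: "'n::finite pair_pre_digraph \<Rightarrow> real" where
  "algebraic_modularity G =
     (GREATEST r. \<exists>x::real ^ 'n. x \<noteq> 0 \<and> x \<bullet> 1 = 0 \<and>
        r = (x \<bullet> (modularity_matrix G *v x)) / (x \<bullet> x))"

lemma algebraic_modularity_attained:
  fixes G :: "'n::finite pair_pre_digraph"
  assumes "2 \<le> CARD('n)"
  shows "\<exists>x::real ^ 'n. x \<noteq> 0 \<and> x \<bullet> 1 = 0 \<and>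
           algebraic_modularity G = (x \<bullet> (modularity_matrix G *v x)) / (x \<bullet> x)"
    and "\<And>x::real ^ 'n. x \<noteq> 0 \<Longrightarrow> x \<bullet> 1 = 0 \<Longrightarrow>
           (x \<bullet> (modularity_matrix G *v x)) / (x \<bullet> x) \<le> algebraic_modularity G"
proof -
  let ?M = "modularity_matrix G"
  let ?q = "\<lambda>x::real ^ 'n. (x \<bullet> (?M *v x)) / (x \<bullet> x)"
  let ?P = "\<lambda>r. \<exists>x::real ^ 'n. x \<noteq> 0 \<and> x \<bullet> 1 = 0 \<and> r = ?q x"
  let ?K = "sphere 0 1 \<inter> {x::real ^ 'n. x \<bullet> 1 = 0}"
  have scale: "?q (c *\<^sub>R x) = ?q x" if "c \<noteq> 0" for c x
    using that by (simp add: matrix_vector_mult_scaleR)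
  have norml: "\<exists>y\<in>?K. ?q y = ?q x" if "x \<noteq> 0" "x \<bullet> 1 = 0" for x
    using that scale[of "inverse (norm x)" x]
    by (intro bexI[of _ "inverse (norm x) *\<^sub>R x"]) auto
  obtain a b :: 'n where ab: "a \<noteq> b"
    using assms by (metis card_2_iff' ex_card UNIV_I)
  have "(axis a 1 - axis b 1 :: real ^ 'n) \<noteq> 0"
    using ab by (auto simp: axis_eq_axis)
  moreover have "(axis a 1 - axis b 1 :: real ^ 'n) \<bullet> 1 = 0"
    by (simp add: inner_diff_left inner_axis')
  ultimately have ne: "?K \<noteq> {}"
    using norml by blast
  have "closed {x::real ^ 'n. x \<bullet> 1 = 0}"
    by (intro closed_Collect_eq continuous_intros)
  then have K: "compact ?K"
    by (intro compact_Int_closed) auto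
  have "continuous_on ?K ?q"
    by (intro continuous_intros matrix_vector_mult_linear_continuous_on) auto
  from continuous_attains_sup[OF K ne this]
  obtain x where x: "x \<in> ?K" "\<And>y. y \<in> ?K \<Longrightarrow> ?q y \<le> ?q x"
    by auto
  have Px: "?P (?q x)"
    using x(1) by (intro exI[of _ x]) auto
  have max: "r \<le> ?q x" if "?P r" for r
    using that norml x(2) by metis
  have eq: "algebraic_modularity G = ?q x"
    unfolding algebraic_modularity_def using Px max by (rule Greatest_equality[where P = ?P])
  show "?P (algebraic_modularity G)"
    using Px unfolding eq .
  show "?q y \<le> algebraic_modularity G" if "y \<noteq> 0" "y \<bullet> 1 = 0" for y
    unfolding eq using that by (intro max) auto
qed

definition norm1 :: "real ^ 'n::finite \<Rightarrow> real" where
  "norm1 x = (\<Sum>i\<in>UNIV. \<bar>x $ i\<bar>)"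

end

theory Submission
  imports Defs
begin

text \<open>
  The bound is obtained by averaging: among the sublevel sets of \<open>f\<close>, the best modularity is at
  least the mean modularity when the threshold is uniform on \<open>[w\<^sub>n, w\<^sub>1]\<close>.  This is the
  level-set argument behind Cheeger's inequality.

  For a \<open>k\<close>-regular graph the entries of the modularity matrix are \<open>m\<^sub>i\<^sub>j = a\<^sub>i\<^sub>j - k/n\<close>.  It is
  symmetric with zero row sums, so \<open>Q(S)\<close> depends only on the pairs that \<open>S\<close> separates:
  \<open>Q(S) = 1/2 \<Sum> (k/n - a\<^sub>i\<^sub>j) \<bar>1\<^sub>S(i) - 1\<^sub>S(j)\<bar>\<close> (lemma \<open>modularity_as_cut\<close>).  A sublevel set of \<open>f\<close>
  separates \<open>i\<close> and \<open>j\<close> exactly for the thresholds in an interval of length \<open>\<bar>f\<^sub>i - f\<^sub>j\<bar>\<close>, so that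
  integrating \<open>Q\<close> over the thresholds replaces the indicators by \<open>f\<close> itself
  (lemma \<open>weighted_modularity_level_sets\<close>):
  \<open>(w\<^sub>1 - w\<^sub>n) Q\<^sub>\<star> \<ge> k/(2n) \<Sum> \<bar>f\<^sub>i - f\<^sub>j\<bar> - 1/2 \<Sum> a\<^sub>i\<^sub>j \<bar>f\<^sub>i - f\<^sub>j\<bar>\<close>.
  Since the integrand is a step function, the integral is the finite sum with weights
  \<open>w\<^sub>l - w\<^sub>l\<^sub>+\<^sub>1\<close>.

  If the entries of \<open>f\<close> sum to zero, both terms are easy to estimate.  The triangle inequality in
  each row gives \<open>\<Sum> \<bar>f\<^sub>i - f\<^sub>j\<bar> \<ge> n \<parallel>f\<parallel>\<^sub>1\<close> (lemma \<open>norm1_le_total_variation\<close>).  The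
  Cauchy-Schwarz inequality bounds the sum over edges in terms of \<open>\<Sum> a\<^sub>i\<^sub>j (f\<^sub>i - f\<^sub>j)\<^sup>2\<close>, which is
  twice the quadratic form of the graph Laplacian and equals \<open>2(k - m(G)) \<parallel>f\<parallel>\<^sub>2\<^sup>2\<close> because \<open>f\<close> is an
  eigenvector (lemmas \<open>dirichlet_form_eigenvector\<close> and \<open>edge_variation_le\<close>).

  An eigenvector for a nonzero eigenvalue is orthogonal to the constant vectors, which lie in
  the kernel.  If \<open>m(G) = 0\<close>, as for the complete bipartite graph \<open>K\<^sub>2\<^sub>,\<^sub>2\<close>, then \<open>f\<close> may have a constant
  component; but in that case \<open>\<parallel>f\<parallel>\<^sub>1 \<le> \<surd>n \<parallel>f\<parallel>\<^sub>2\<close> makes the bound nonpositive, and \<open>Q\<^sub>\<star> \<ge> Q(V) = 0\<close>.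
\<close>

section \<open>Symmetric matrices with constant row sums\<close>

text \<open>
  Expanding the square on the right, each of the two pure terms collapses along a row or a column
  to \<open>r (x \<bullet> x)\<close>, and the mixed term is the quadratic form.  With \<open>r = 0\<close> this turns modularity
  into a cut; with \<open>r = k\<close> it is the Laplacian identity for a \<open>k\<close>-regular graph.
\<close>

lemma quadratic_form_constant_row_sums:
  fixes B :: "real ^ 'n ^ 'n::finite"
  assumes sym: "\<And>i j. B $ i $ j = B $ j $ i"
    and row: "\<And>i. (\<Sum>j\<in>UNIV. B $ i $ j) = r"
  shows "x \<bullet> (B *v x) = r * (x \<bullet> x) - (\<Sum>i\<in>UNIV. \<Sum>j\<in>UNIV. B $ i $ j * (x $ i - x $ j)\<^sup>2) / 2"
proof -
  have diag: "(\<Sum>i\<in>UNIV. \<Sum>j\<in>UNIV. B $ i $ j * (x $ i)\<^sup>2) = r * (x \<bullet> x)"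
    by (simp add: row inner_vec_def power2_eq_square sum_distrib_left flip: sum_distrib_right)
  have diag': "(\<Sum>i\<in>UNIV. \<Sum>j\<in>UNIV. B $ i $ j * (x $ j)\<^sup>2) = r * (x \<bullet> x)"
    by (subst sum.swap, subst sym) (rule diag)
  have form: "x \<bullet> (B *v x) = (\<Sum>i\<in>UNIV. \<Sum>j\<in>UNIV. B $ i $ j * (x $ i * x $ j))"
    by (simp add: inner_vec_def matrix_vector_mult_def sum_distrib_left mult.left_commute)
  have "(\<Sum>i\<in>UNIV. \<Sum>j\<in>UNIV. B $ i $ j * (x $ i - x $ j)\<^sup>2)
      = (\<Sum>i\<in>UNIV. \<Sum>j\<in>UNIV. B $ i $ j * (x $ i)\<^sup>2 + B $ i $ j * (x $ j)\<^sup>2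
           - 2 * (B $ i $ j * (x $ i * x $ j)))"
    by (intro sum.cong refl) (simp add: power2_eq_square algebra_simps)
  also have "\<dots> = 2 * (r * (x \<bullet> x)) - 2 * (x \<bullet> (B *v x))"
    by (simp add: sum.distrib sum_subtractf diag diag' form flip: sum_distrib_left)
  finally show ?thesis by (simp add: diff_divide_distrib)
qed

section \<open>The modularity matrix of a regular graph\<close>

lemma adjacency_matrix_symmetric:
  assumes "pair_graph G"
  shows "adjacency_matrix G $ i $ j = adjacency_matrix G $ j $ i"
proof -
  interpret pair_graph G by fact
  show ?thesis
    using arcs_symmetric by (auto simp: adjacency_matrix_def)
qed

lemma adjacency_matrix_row_sum:
  assumes "regular_graph k G"
  shows "(\<Sum>j\<in>UNIV. adjacency_matrix G $ i $ j) = real k"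
  using assms by (simp add: regular_graph_def degree_vec_def)

lemma modularity_matrix_regular:
  fixes G :: "'n::finite pair_pre_digraph"
  assumes "regular_graph k G"
  shows "modularity_matrix G $ i $ j = adjacency_matrix G $ i $ j - real k / real CARD('n)"
  using assms by (simp add: modularity_matrix_def regular_graph_def graph_volume_def)

lemma modularity_matrix_row_sum:
  fixes G :: "'n::finite pair_pre_digraph"
  assumes "regular_graph k G"
  shows "(\<Sum>j\<in>UNIV. modularity_matrix G $ i $ j) = 0"
  by (simp add: modularity_matrix_regular[OF assms] sum_subtractf adjacency_matrix_row_sum[OF assms])

lemma modularity_matrix_symmetric:
  assumes "pair_graph G"
  shows "modularity_matrix G $ i $ j = modularity_matrix G $ j $ i"
  by (simp add: modularity_matrix_def adjacency_matrix_symmetric[OF assms, of i j] mult.commute)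

text \<open>
  For indicator vectors \<open>(x\<^sub>i - x\<^sub>j)\<^sup>2 = \<bar>x\<^sub>i - x\<^sub>j\<bar>\<close>.  The absolute value is the form that is
  additive along the chain of level sets.
\<close>

lemma modularity_as_cut:
  fixes G :: "'n::finite pair_pre_digraph"
  assumes "pair_graph G" "regular_graph k G"
  shows "modularity G S =
    - (\<Sum>i\<in>UNIV. \<Sum>j\<in>UNIV. modularity_matrix G $ i $ j * \<bar>of_bool (i \<in> S) - of_bool (j \<in> S)\<bar>) / 2"
proof -
  have "(char_vec S $ i - char_vec S $ j)\<^sup>2 = \<bar>of_bool (i \<in> S) - of_bool (j \<in> S)\<bar>" for i j :: 'n
    by (simp add: char_vec_def)
  then show ?thesis
    using quadratic_form_constant_row_sums[OF modularity_matrix_symmetric[OF assms(1)]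
        modularity_matrix_row_sum[OF assms(2)], of "char_vec S"]
    by (simp add: modularity_def)
qed

text \<open>
  On vectors with sum zero the rank-one correction \<open>k/n\<close> vanishes, so \<open>f\<close> is an eigenvector of the
  adjacency matrix with the same eigenvalue.
\<close>

lemma dirichlet_form_eigenvector:
  fixes G :: "'n::finite pair_pre_digraph"
  assumes "pair_graph G" "regular_graph k G"
    and eig: "modularity_matrix G *v f = \<mu> *\<^sub>R f"
    and mean: "(\<Sum>i\<in>UNIV. f $ i) = 0"
  shows "(\<Sum>i\<in>UNIV. \<Sum>j\<in>UNIV. adjacency_matrix G $ i $ j * (f $ i - f $ j)\<^sup>2)
           = 2 * (real k - \<mu>) * (norm f)\<^sup>2"
proof -
  have "adjacency_matrix G *v f = modularity_matrix G *v f"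
    by (simp add: vec_eq_iff matrix_vector_mult_def modularity_matrix_regular[OF assms(2)]
        left_diff_distrib sum_subtractf mean flip: sum_distrib_left sum_divide_distrib)
  then have "f \<bullet> (adjacency_matrix G *v f) = \<mu> * (f \<bullet> f)"
    by (simp add: eig)
  then show ?thesis
    using quadratic_form_constant_row_sums[OF adjacency_matrix_symmetric[OF assms(1)]
        adjacency_matrix_row_sum[OF assms(2)], of f]
    by (simp add: power2_norm_eq_inner algebra_simps)
qed

text \<open>
  The constant vectors lie in the kernel of the symmetric matrix, and eigenspaces of different
  eigenvalues are orthogonal.
\<close>

lemma eigenvector_mean_zero:
  fixes G :: "'n::finite pair_pre_digraph"
  assumes "pair_graph G" "regular_graph k G"
    and eig: "modularity_matrix G *v f = \<mu> *\<^sub>R f" and "\<mu> \<noteq> 0"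
  shows "(\<Sum>i\<in>UNIV. f $ i) = 0"
proof -
  have "\<mu> * (\<Sum>i\<in>UNIV. f $ i) = (\<Sum>i\<in>UNIV. (modularity_matrix G *v f) $ i)"
    by (simp add: eig sum_distrib_left)
  also have "\<dots> = (\<Sum>j\<in>UNIV. (\<Sum>i\<in>UNIV. modularity_matrix G $ j $ i) * f $ j)"
    unfolding matrix_vector_mult_def
    by (simp add: sum_distrib_right modularity_matrix_symmetric[OF assms(1)])
       (subst sum.swap, simp add: modularity_matrix_symmetric[OF assms(1)])
  also have "\<dots> = 0"
    by (simp add: modularity_matrix_row_sum[OF assms(2)])
  finally show ?thesis using \<open>\<mu> \<noteq> 0\<close> by simp
qed

section \<open>Edge variation and total variation\<close>

text \<open>
  Cauchy-Schwarz over ordered pairs, for \<open>a\<^sub>i\<^sub>j\<close> against \<open>a\<^sub>i\<^sub>j \<bar>f\<^sub>i - f\<^sub>j\<bar>\<close>: as the entries \<open>a\<^sub>i\<^sub>j\<close> are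
  0 or 1, they equal their squares, and \<open>\<Sum> a\<^sub>i\<^sub>j\<^sup>2\<close> counts each of the \<open>k n / 2\<close> edges twice.
\<close>

lemma edge_variation_le:
  fixes G :: "'n::finite pair_pre_digraph"
  assumes "pair_graph G" "regular_graph k G"
    and eig: "modularity_matrix G *v f = \<mu> *\<^sub>R f"
    and mean: "(\<Sum>i\<in>UNIV. f $ i) = 0"
  shows "(\<Sum>i\<in>UNIV. \<Sum>j\<in>UNIV. adjacency_matrix G $ i $ j * \<bar>f $ i - f $ j\<bar>) / 2
           \<le> norm f * sqrt ((real k - \<mu>) * (real k * real CARD('n) / 2))"
proof -
  let ?a = "\<lambda>(i, j). adjacency_matrix G $ i $ j"
  let ?d = "\<lambda>(i, j). \<bar>f $ i - f $ j\<bar>"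
  let ?C = "\<Sum>i\<in>UNIV. \<Sum>j\<in>UNIV. adjacency_matrix G $ i $ j * \<bar>f $ i - f $ j\<bar>"
  have idem: "?a p * ?a p = ?a p" for p
    by (auto simp: adjacency_matrix_def split: prod.split)
  have "?C\<^sup>2 = (\<Sum>p\<in>UNIV \<times> UNIV. ?a p * (?a p * ?d p))\<^sup>2"
    by (simp add: sum.cartesian_product idem mult.assoc[symmetric] case_prod_unfold)
       (simp add: idem[unfolded case_prod_unfold])
  also have "\<dots> \<le> (\<Sum>p\<in>UNIV \<times> UNIV. (?a p)\<^sup>2) * (\<Sum>p\<in>UNIV \<times> UNIV. (?a p * ?d p)\<^sup>2)"
    by (rule Cauchy_Schwarz_ineq_sum)
  also have "(\<Sum>p\<in>UNIV \<times> UNIV. (?a p)\<^sup>2) = (\<Sum>i\<in>UNIV. \<Sum>j\<in>UNIV. adjacency_matrix G $ i $ j)"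
    by (simp add: power2_eq_square idem sum.cartesian_product)
  also have "(\<Sum>i\<in>UNIV. \<Sum>j\<in>UNIV. adjacency_matrix G $ i $ j) = real k * real CARD('n)"
    by (simp add: adjacency_matrix_row_sum[OF assms(2)])
  also have "(\<Sum>p\<in>UNIV \<times> UNIV. (?a p * ?d p)\<^sup>2)
      = (\<Sum>i\<in>UNIV. \<Sum>j\<in>UNIV. adjacency_matrix G $ i $ j * (f $ i - f $ j)\<^sup>2)"
    unfolding sum.cartesian_product
    by (intro sum.cong refl) (auto simp: adjacency_matrix_def)
  also have "\<dots> = 2 * (real k - \<mu>) * (norm f)\<^sup>2"
    by (rule dirichlet_form_eigenvector[OF assms])
  finally have "(?C / 2)\<^sup>2 \<le> (norm f)\<^sup>2 * ((real k - \<mu>) * (real k * real CARD('n) / 2))"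
    by (simp add: power_divide algebra_simps)
  then have "?C / 2 \<le> sqrt ((norm f)\<^sup>2 * ((real k - \<mu>) * (real k * real CARD('n) / 2)))"
    by (rule real_le_rsqrt)
  then show ?thesis
    unfolding real_sqrt_mult[of "(norm f)\<^sup>2"] by simp
qed

lemma norm1_le_total_variation:
  fixes f :: "real ^ 'n::finite"
  assumes mean: "(\<Sum>i\<in>UNIV. f $ i) = 0"
  shows "real CARD('n) * norm1 f \<le> (\<Sum>i\<in>UNIV. \<Sum>j\<in>UNIV. \<bar>f $ i - f $ j\<bar>)"
  unfolding norm1_def sum_distrib_left
proof (rule sum_mono)
  fix i :: 'n
  have "real CARD('n) * \<bar>f $ i\<bar> = \<bar>\<Sum>j\<in>UNIV. f $ i - f $ j\<bar>"
    by (simp add: sum_subtractf mean abs_mult)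
  also have "\<dots> \<le> (\<Sum>j\<in>UNIV. \<bar>f $ i - f $ j\<bar>)"
    by (rule sum_abs)
  finally show "real CARD('n) * \<bar>f $ i\<bar> \<le> (\<Sum>j\<in>UNIV. \<bar>f $ i - f $ j\<bar>)" .
qed

lemma norm1_le_norm:
  fixes f :: "real ^ 'n::finite"
  shows "norm1 f \<le> norm f * sqrt (real CARD('n))"
proof -
  have "(norm1 f)\<^sup>2 \<le> (\<Sum>i\<in>(UNIV::'n set). 1\<^sup>2) * (\<Sum>i\<in>UNIV. \<bar>f $ i\<bar>\<^sup>2)"
    unfolding norm1_def
    using Cauchy_Schwarz_ineq_sum[of "\<lambda>_. 1" "\<lambda>i. \<bar>f $ i\<bar>" UNIV] by simp
  also have "\<dots> = (norm f)\<^sup>2 * real CARD('n)"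
    by (simp add: power2_norm_eq_inner inner_vec_def) (simp add: power2_eq_square)
  finally have "norm1 f \<le> sqrt ((norm f)\<^sup>2 * real CARD('n))"
    by (rule real_le_rsqrt)
  then show ?thesis by (simp add: real_sqrt_mult)
qed

section \<open>Averaging over level sets\<close>

text \<open>
  The Lebesgue measure of the thresholds in \<open>[v, w\<^sub>1]\<close>, for a value \<open>v = w\<^sub>q\<close>, written as a sum over
  consecutive values.
\<close>

lemma weighted_sublevel_count:
  fixes w :: "nat \<Rightarrow> real"
  assumes sorted: "\<And>i j. 1 \<le> i \<Longrightarrow> i \<le> j \<Longrightarrow> j \<le> n \<Longrightarrow> w j \<le> w i"
    and q: "q \<in> {1..n}"
  shows "(\<Sum>i\<in>{1..<n}. (w i - w (Suc i)) * of_bool (w q \<le> w (Suc i))) = w 1 - w q"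
proof -
  \<comment> \<open>Past \<open>q\<close> the condition can still hold because of ties, but then \<open>w\<^sub>i = w\<^sub>i\<^sub>+\<^sub>1\<close> and the weight is zero.\<close>
  have "(w i - w (Suc i)) * of_bool (w q \<le> w (Suc i)) = (if i < q then w i - w (Suc i) else 0)"
    if i: "i \<in> {1..<n}" for i
  proof (cases "i < q")
    case True
    then show ?thesis using sorted[of "Suc i" q] q i by auto
  next
    case False
    then show ?thesis using sorted[of q i] sorted[of i "Suc i"] q i by auto
  qed
  then have "(\<Sum>i\<in>{1..<n}. (w i - w (Suc i)) * of_bool (w q \<le> w (Suc i)))
      = (\<Sum>i\<in>{1..<n}. if i < q then w i - w (Suc i) else 0)"
    by (intro sum.cong refl)
  also have "\<dots> = (\<Sum>i\<in>{1..<q}. w i - w (Suc i))"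
    using q by (intro sum.mono_neutral_cong_right) auto
  also have "\<dots> = - (\<Sum>i\<in>{1..<q}. w (Suc i) - w i)"
    by (simp add: sum_negf[symmetric])
  also have "\<dots> = w 1 - w q"
    using q by (subst sum_Suc_diff') auto
  finally show ?thesis .
qed

text \<open>
  Sublevel sets are nested, so the indicators of \<open>a\<close> and \<open>b\<close> differ in a constant direction, and the
  absolute value is the difference of two sums of the preceding kind.
\<close>

lemma weighted_level_separation:
  fixes w :: "nat \<Rightarrow> real"
  assumes sorted: "\<And>i j. 1 \<le> i \<Longrightarrow> i \<le> j \<Longrightarrow> j \<le> n \<Longrightarrow> w j \<le> w i"
    and "a \<in> w ` {1..n}" "b \<in> w ` {1..n}"
  shows "(\<Sum>i\<in>{1..<n}. (w i - w (Suc i)) *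
            \<bar>of_bool (a \<le> w (Suc i)) - of_bool (b \<le> w (Suc i))\<bar>) = \<bar>a - b\<bar>"
  using assms(2,3)
proof (induction a b rule: linorder_wlog)
  case (sym a b)
  then show ?case by (simp add: abs_minus_commute)
next
  case (le a b)
  have count: "(\<Sum>i\<in>{1..<n}. (w i - w (Suc i)) * of_bool (v \<le> w (Suc i))) = w 1 - v"
    if "v \<in> w ` {1..n}" for v
    using that weighted_sublevel_count[of n w, OF sorted] by blast
  have "(\<Sum>i\<in>{1..<n}. (w i - w (Suc i)) *
            \<bar>of_bool (a \<le> w (Suc i)) - of_bool (b \<le> w (Suc i))\<bar>)
      = (\<Sum>i\<in>{1..<n}. (w i - w (Suc i)) * of_bool (a \<le> w (Suc i))
           - (w i - w (Suc i)) * of_bool (b \<le> w (Suc i)))"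
    using le(1) by (intro sum.cong refl) auto
  also have "\<dots> = (w 1 - a) - (w 1 - b)"
    unfolding sum_subtractf using count[OF le(2)] count[OF le(3)] by (rule arg_cong2)
  finally show ?case using le(1) by simp
qed

text \<open>
  Modularity is linear in the separation indicators, so the weighted sum can be taken pair by pair,
  where it produces \<open>\<bar>f\<^sub>i - f\<^sub>j\<bar>\<close>.
\<close>

lemma weighted_modularity_level_sets:
  fixes G :: "'n::finite pair_pre_digraph" and f :: "real ^ 'n" and w :: "nat \<Rightarrow> real"
  assumes "pair_graph G" "regular_graph k G"
    and sorted: "\<And>i j. 1 \<le> i \<Longrightarrow> i \<le> j \<Longrightarrow> j \<le> n \<Longrightarrow> w j \<le> w i"
    and vals: "\<And>j. f $ j \<in> w ` {1..n}"
  shows "(\<Sum>l\<in>{1..<n}. (w l - w (Suc l)) * modularity G {j. f $ j \<le> w (Suc l)})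
    = real k / real CARD('n) * (\<Sum>i\<in>UNIV. \<Sum>j\<in>UNIV. \<bar>f $ i - f $ j\<bar>) / 2
      - (\<Sum>i\<in>UNIV. \<Sum>j\<in>UNIV. adjacency_matrix G $ i $ j * \<bar>f $ i - f $ j\<bar>) / 2"
proof -
  let ?M = "modularity_matrix G"
  let ?s = "\<lambda>i j l. \<bar>of_bool (f $ i \<le> w (Suc l)) - of_bool (f $ j \<le> w (Suc l))\<bar> :: real"
  have "(\<Sum>l\<in>{1..<n}. (w l - w (Suc l)) * modularity G {j. f $ j \<le> w (Suc l)})
      = - (\<Sum>l\<in>{1..<n}. \<Sum>i\<in>UNIV. \<Sum>j\<in>UNIV. ?M $ i $ j * ((w l - w (Suc l)) * ?s i j l)) / 2"
    by (simp add: modularity_as_cut[OF assms(1,2)] sum_distrib_left mult.left_commute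
        sum_negf sum_divide_distrib)
  also have "(\<Sum>l\<in>{1..<n}. \<Sum>i\<in>UNIV. \<Sum>j\<in>UNIV. ?M $ i $ j * ((w l - w (Suc l)) * ?s i j l))
      = (\<Sum>i\<in>UNIV. \<Sum>j\<in>UNIV. \<Sum>l\<in>{1..<n}. ?M $ i $ j * ((w l - w (Suc l)) * ?s i j l))"
    by (subst sum.swap, rule sum.cong[OF refl], rule sum.swap)
  also have "\<dots> = (\<Sum>i\<in>UNIV. \<Sum>j\<in>UNIV. ?M $ i $ j * \<bar>f $ i - f $ j\<bar>)"
    unfolding sum_distrib_left[symmetric]
    using weighted_level_separation[OF sorted vals vals] by simp
  also have "- \<dots> / 2
      = real k / real CARD('n) * (\<Sum>i\<in>UNIV. \<Sum>j\<in>UNIV. \<bar>f $ i - f $ j\<bar>) / 2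
        - (\<Sum>i\<in>UNIV. \<Sum>j\<in>UNIV. adjacency_matrix G $ i $ j * \<bar>f $ i - f $ j\<bar>) / 2"
    unfolding modularity_matrix_regular[OF assms(2)] left_diff_distrib sum_subtractf
      sum_distrib_left[symmetric]
    by (simp add: diff_divide_distrib)
  finally show ?thesis .
qed

section \<open>The lower bound on the best level set\<close>

theorem theorem7p1:
  fixes G :: "'n::finite pair_pre_digraph"
    and k :: nat
    and f :: "real ^ 'n"
    and w :: "nat \<Rightarrow> real"
    and S :: "nat \<Rightarrow> 'n set"
    and n :: nat
    and Qstar :: real
  assumes n_def: "n = CARD('n)"
    and graph: "pair_graph G" "pverts G = UNIV"
    and conn: "Digraph_Component.connected (with_proj G)"
    and reg: "regular_graph k G"
    and f_nonzero: "f \<noteq> 0"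
    and f_eigenvector: "modularity_matrix G *v f = algebraic_modularity G *\<^sub>R f"
    and w_values: "image_mset w (mset_set {1..n}) = image_mset (\<lambda>j. f $ j) (mset_set UNIV)"
    and w_sorted: "\<And>i j. 1 \<le> i \<Longrightarrow> i \<le> j \<Longrightarrow> j \<le> n \<Longrightarrow> w j \<le> w i"
    and S_def: "\<And>i. i \<in> {1..n} \<Longrightarrow> S i = {j. f $ j \<le> w i}"
    and Qstar_def: "Qstar = Max ((\<lambda>i. modularity G (S i)) ` {1..n})"
  shows "Qstar \<ge> 1 / (w 1 - w n) *
           (real k / 2 * norm1 f
            - norm f * sqrt ((real k - algebraic_modularity G) * (real k * real n / 2)))"
proof -
  let ?m = "algebraic_modularity G"
  let ?R = "real k / 2 * norm1 f - norm f * sqrt ((real k - ?m) * (real k * real n / 2))"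
  have n: "n \<ge> 1"
    by (simp add: n_def Suc_le_eq)
  have "w ` {1..n} = range (\<lambda>j. f $ j)"
    using arg_cong[OF w_values, of set_mset] by simp
  then have vals: "f $ j \<in> w ` {1..n}" for j by blast
  have Q_le: "modularity G {j. f $ j \<le> w i} \<le> Qstar" if "i \<in> {1..n}" for i
    unfolding Qstar_def S_def[OF that, symmetric] using that by (intro Max_ge) auto
  \<comment> \<open>The largest threshold gives the whole vertex set, of modularity zero.\<close>
  have "f $ j \<le> w 1" for j
    using vals[of j] w_sorted[of 1] by auto
  then have Q_nonneg: "0 \<le> Qstar"
    using Q_le[of 1] n by (simp add: modularity_as_cut[OF graph(1) reg])
  have w_le: "w n \<le> w 1"
    using w_sorted[of 1 n] n by simp
  show ?thesis
  proof (cases "?m = 0")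
    case True
    \<comment> \<open>Here \<open>f\<close> need not have mean zero, but the bound is at most zero: the square root is \<open>\<surd>(k\<^sup>2 n / 2)\<close>, and \<open>k/2 \<parallel>f\<parallel>\<^sub>1\<close> is at most \<open>\<parallel>f\<parallel>\<^sub>2 \<surd>(k\<^sup>2 n / 4)\<close>.\<close>
    have "real k / 2 * norm1 f \<le> real k / 2 * (norm f * sqrt (real n))"
      unfolding n_def by (intro mult_left_mono norm1_le_norm) simp
    also have "\<dots> = norm f * sqrt ((real k / 2)\<^sup>2 * real n)"
      by (simp add: real_sqrt_mult)
    also have "\<dots> \<le> norm f * sqrt ((real k - ?m) * (real k * real n / 2))"
      unfolding True by (intro mult_left_mono real_sqrt_le_mono) (auto simp: power2_eq_square)
    finally have "?R \<le> 0" by simp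
    then have "1 / (w 1 - w n) * ?R \<le> 0"
      using w_le by (intro mult_nonneg_nonpos) auto
    then show ?thesis using Q_nonneg by linarith
  next
    case False
    have mean: "(\<Sum>i\<in>UNIV. f $ i) = 0"
      by (rule eigenvector_mean_zero[OF graph(1) reg f_eigenvector False])
    have "real k / 2 * norm1 f = real k / real n / 2 * (real n * norm1 f)"
      using n by simp
    also have "\<dots> \<le> real k / real n / 2 * (\<Sum>i\<in>UNIV. \<Sum>j\<in>UNIV. \<bar>f $ i - f $ j\<bar>)"
      using norm1_le_total_variation[OF mean] unfolding n_def by (intro mult_left_mono) auto
    also have "\<dots> = real k / real n * (\<Sum>i\<in>UNIV. \<Sum>j\<in>UNIV. \<bar>f $ i - f $ j\<bar>) / 2"
      by simp
    finally have "?R \<le> real k / real n * (\<Sum>i\<in>UNIV. \<Sum>j\<in>UNIV. \<bar>f $ i - f $ j\<bar>) / 2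
        - (\<Sum>i\<in>UNIV. \<Sum>j\<in>UNIV. adjacency_matrix G $ i $ j * \<bar>f $ i - f $ j\<bar>) / 2"
      using edge_variation_le[OF graph(1) reg f_eigenvector mean] unfolding n_def
      by (rule diff_mono)
    also have "\<dots> = (\<Sum>l\<in>{1..<n}. (w l - w (Suc l)) * modularity G {j. f $ j \<le> w (Suc l)})"
      using weighted_modularity_level_sets[OF graph(1) reg w_sorted vals] unfolding n_def by simp
    also have "\<dots> \<le> (\<Sum>l\<in>{1..<n}. (w l - w (Suc l)) * Qstar)"
      using w_sorted by (intro sum_mono mult_left_mono Q_le) auto
    also have "\<dots> = (w 1 - w n) * Qstar"
      using sum_Suc_diff'[of 1 n "\<lambda>i. - w i"] n by (simp flip: sum_distrib_right)
    finally have R_le: "?R \<le> (w 1 - w n) * Qstar" .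
    show ?thesis
    proof (cases "w 1 = w n")
      case True
      \<comment> \<open>The prefactor is \<open>1 / 0 = 0\<close>.\<close>
      then show ?thesis using Q_nonneg by simp
    next
      case False
      then show ?thesis using R_le w_le by (simp add: field_simps)
    qed
  qed
qed

end
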